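(* Let $n\ge 1$. The rational loop group $\mathcal{L}^-\mathrm{GL}_n\mathbb{C}$ is generated (as a group) by the projective loops $$p_{\alpha,\beta,V,W}(\lambda)=\left(\frac{\lambda-\alpha}{\lambda-\beta}\right)\pi_V+\pi_W,$$ where $\alpha\ne\beta$ range over $\mathbb{C}$ and $(V,W)$ ranges over all pairs of complex subspaces with $\mathbb{C}^n=V\oplus W$.
   Context: $\mathcal{L}^-\mathrm{GL}_n\mathbb{C}$ denotes the group (under pointwise multiplication) of all non-degenerate (i.e. determinant not identically zero) $n\times n$ matrices $g=g(\lambda)$ whose entries are rational functions of $\lambda$ with complex coefficients, normalized at infinity by $g(\infty)=\mathrm{I}$. For a decomposition $\mathbb{C}^n=V\oplus W$, $\pi_V$ is the projection onto $V$ along $W$ and $\pi_W$ the projection onto $W$ along $V$. *)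

theory Defs
  imports
    "HOL-Analysis.Analysis"
    "HOL-Algebra.Generated_Groups"
    "HOL-Computational_Algebra.Polynomial_Factorial"
begin

text \<open>Rational functions of \<open>\<lambda>\<close> with complex coefficients; \<open>\<lambda>\<close> itself is \<open>to_fract [:0, 1:]\<close>.\<close>

type_synonym ratfun = "complex poly fract"

definition const_ratfun :: "complex \<Rightarrow> ratfun" where
  "const_ratfun c = to_fract [:c:]"

text \<open>\<open>f(\<infinity>) = c\<close>. The limit does not depend on the chosen representation of \<open>f\<close> as a
  quotient of polynomials, so the existential quantifier is harmless (see
  \<open>value_at_infinity_representation\<close> below).\<close>

definition has_value_at_infinity :: "ratfun \<Rightarrow> complex \<Rightarrow> bool" where
  "has_value_at_infinity f c \<longleftrightarrow>
     (\<exists>p q. q \<noteq> 0 \<and> f = to_fract p / to_fract q \<and>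
            ((\<lambda>z. poly p z / poly q z) \<longlongrightarrow> c) at_infinity)"

definition rational_loop_group :: "(ratfun ^ 'n ^ 'n) monoid" where
  "rational_loop_group =
     \<lparr>carrier = {g. det g \<noteq> 0 \<and>
                    (\<forall>i j. has_value_at_infinity (g $ i $ j) ((mat 1 :: complex ^ 'n ^ 'n) $ i $ j))},
      mult = (**),
      one = mat 1\<rparr>"

definition complementary :: "(complex ^ 'n) set \<Rightarrow> (complex ^ 'n) set \<Rightarrow> bool" where
  "complementary V W \<longleftrightarrow>
     vec.subspace V \<and> vec.subspace W \<and> V \<inter> W = {0} \<and> {v + w | v w. v \<in> V \<and> w \<in> W} = UNIV"

text \<open>The projection onto \<open>V\<close> along \<open>W\<close>; only meaningful if \<open>V\<close> and \<open>W\<close> are complementary.\<close>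

definition proj_along :: "(complex ^ 'n) set \<Rightarrow> (complex ^ 'n) set \<Rightarrow> complex ^ 'n \<Rightarrow> complex ^ 'n" where
  "proj_along V W x = (THE v. v \<in> V \<and> x - v \<in> W)"

definition projective_loop ::
  "complex \<Rightarrow> complex \<Rightarrow> (complex ^ 'n) set \<Rightarrow> (complex ^ 'n) set \<Rightarrow> ratfun ^ 'n ^ 'n" where
  "projective_loop \<alpha> \<beta> V W =
     (\<chi> i j. (to_fract [:- \<alpha>, 1:] / to_fract [:- \<beta>, 1:]) * const_ratfun (matrix (proj_along V W) $ i $ j)
             + const_ratfun (matrix (proj_along W V) $ i $ j))"

definition projective_loops :: "(ratfun ^ 'n ^ 'n) set" where
  "projective_loops = {projective_loop \<alpha> \<beta> V W | \<alpha> \<beta> V W. \<alpha> \<noteq> \<beta> \<and> complementary V W}"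

lemma eventually_poly_nonzero:
  fixes q :: "complex poly"
  assumes "q \<noteq> 0"
  shows "eventually (\<lambda>z. poly q z \<noteq> 0) at_infinity"
proof -
  have "bounded {z. poly q z = 0}"
    using poly_roots_finite[OF assms] by (rule finite_imp_bounded)
  then obtain B where "\<And>z. poly q z = 0 \<Longrightarrow> norm z \<le> B"
    unfolding bounded_iff by blast
  then have "\<forall>z. B + 1 \<le> norm z \<longrightarrow> poly q z \<noteq> 0" by force
  then show ?thesis unfolding eventually_at_infinity by blast
qed

lemma value_at_infinity_representation:
  assumes "q \<noteq> 0"
  shows "has_value_at_infinity (to_fract p / to_fract q) c \<longleftrightarrow>
           ((\<lambda>z. poly p z / poly q z) \<longlongrightarrow> c) at_infinity"
proof
  assume "has_value_at_infinity (to_fract p / to_fract q) c"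
  then obtain p' q' where q': "q' \<noteq> 0" and eq: "to_fract p / to_fract q = to_fract p' / to_fract q'"
    and lim: "((\<lambda>z. poly p' z / poly q' z) \<longlongrightarrow> c) at_infinity"
    unfolding has_value_at_infinity_def by blast
  have "to_fract (p * q') = to_fract (p' * q)"
    using eq assms q' by (simp add: frac_eq_eq)
  then have "p * q' = p' * q" by (simp only: to_fract_eq_iff)
  then have cross: "poly p z * poly q' z = poly p' z * poly q z" for z
    by (metis poly_mult)
  have "eventually (\<lambda>z. poly p' z / poly q' z = poly p z / poly q z) at_infinity"
    using eventually_poly_nonzero[OF assms] eventually_poly_nonzero[OF q']
    by eventually_elim (metis cross frac_eq_eq)
  then show "((\<lambda>z. poly p z / poly q z) \<longlongrightarrow> c) at_infinity"
    using lim by (rule Lim_transform_eventually[rotated])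
next
  assume "((\<lambda>z. poly p z / poly q z) \<longlongrightarrow> c) at_infinity"
  then show "has_value_at_infinity (to_fract p / to_fract q) c"
    unfolding has_value_at_infinity_def using assms by blast
qed

lemma value_at_infinity_unique:
  assumes "has_value_at_infinity f c" "has_value_at_infinity f d"
  shows "c = d"
proof -
  obtain p q where "q \<noteq> 0" "f = to_fract p / to_fract q"
    using assms(1) unfolding has_value_at_infinity_def by blast
  then have "((\<lambda>z. poly p z / poly q z) \<longlongrightarrow> c) at_infinity"
    and "((\<lambda>z. poly p z / poly q z) \<longlongrightarrow> d) at_infinity"
    using assms by (simp_all add: value_at_infinity_representation)
  then show ?thesis by (rule tendsto_unique[OF trivial_limit_at_infinity])
qed

lemma has_value_at_infinity_const [simp]: "has_value_at_infinity (const_ratfun c) c"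
  using value_at_infinity_representation[of 1 "[:c:]" c] by (simp add: const_ratfun_def)

lemma has_value_at_infinity_0 [simp]: "has_value_at_infinity 0 0"
  and has_value_at_infinity_1 [simp]: "has_value_at_infinity 1 1"
  using has_value_at_infinity_const[of 0] has_value_at_infinity_const[of 1]
  by (simp_all add: const_ratfun_def flip: one_pCons)

lemma has_value_at_infinity_mult:
  assumes "has_value_at_infinity f c" "has_value_at_infinity g d"
  shows "has_value_at_infinity (f * g) (c * d)"
proof -
  obtain p q p' q' where *: "q \<noteq> 0" "f = to_fract p / to_fract q" "q' \<noteq> 0" "g = to_fract p' / to_fract q'"
    "((\<lambda>z. poly p z / poly q z) \<longlongrightarrow> c) at_infinity" "((\<lambda>z. poly p' z / poly q' z) \<longlongrightarrow> d) at_infinity"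
    using assms unfolding has_value_at_infinity_def by blast
  have "f * g = to_fract (p * p') / to_fract (q * q')" "q * q' \<noteq> 0"
    using * by simp_all
  moreover have "((\<lambda>z. poly (p * p') z / poly (q * q') z) \<longlongrightarrow> c * d) at_infinity"
    using tendsto_mult[OF *(5,6)] by simp
  ultimately show ?thesis using value_at_infinity_representation by metis
qed

lemma has_value_at_infinity_add:
  assumes "has_value_at_infinity f c" "has_value_at_infinity g d"
  shows "has_value_at_infinity (f + g) (c + d)"
proof -
  obtain p q p' q' where *: "q \<noteq> 0" "f = to_fract p / to_fract q" "q' \<noteq> 0" "g = to_fract p' / to_fract q'"
    "((\<lambda>z. poly p z / poly q z) \<longlongrightarrow> c) at_infinity" "((\<lambda>z. poly p' z / poly q' z) \<longlongrightarrow> d) at_infinity"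
    using assms unfolding has_value_at_infinity_def by blast
  have fg: "f + g = to_fract (p * q' + p' * q) / to_fract (q * q')" "q * q' \<noteq> 0"
    using * by (simp_all add: add_frac_eq)
  have "eventually (\<lambda>z. poly p z / poly q z + poly p' z / poly q' z
          = poly (p * q' + p' * q) z / poly (q * q') z) at_infinity"
    using eventually_poly_nonzero[OF *(1)] eventually_poly_nonzero[OF *(3)]
    by eventually_elim (simp add: add_frac_eq)
  then have "((\<lambda>z. poly (p * q' + p' * q) z / poly (q * q') z) \<longlongrightarrow> c + d) at_infinity"
    by (rule Lim_transform_eventually[OF tendsto_add[OF *(5,6)]])
  then show ?thesis using fg value_at_infinity_representation by metis
qed

lemma has_value_at_infinity_inverse:
  assumes "has_value_at_infinity f c" "c \<noteq> 0"
  shows "has_value_at_infinity (inverse f) (inverse c)"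
proof -
  obtain p q where *: "q \<noteq> 0" "f = to_fract p / to_fract q"
    "((\<lambda>z. poly p z / poly q z) \<longlongrightarrow> c) at_infinity"
    using assms unfolding has_value_at_infinity_def by blast
  have "p \<noteq> 0"
  proof
    assume "p = 0"
    then have "((\<lambda>z::complex. 0) \<longlongrightarrow> c) at_infinity" using *(3) by simp
    then show False using assms(2) tendsto_unique[OF trivial_limit_at_infinity tendsto_const] by metis
  qed
  moreover have "((\<lambda>z. poly q z / poly p z) \<longlongrightarrow> inverse c) at_infinity"
    using tendsto_inverse[OF *(3) assms(2)] by simp
  ultimately show ?thesis using *(2) value_at_infinity_representation[of p q] by simp
qed

lemma has_value_at_infinity_sum:
  "(\<And>i. i \<in> A \<Longrightarrow> has_value_at_infinity (f i) (c i)) \<Longrightarrow> has_value_at_infinity (sum f A) (sum c A)"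
  by (induction A rule: infinite_finite_induct) (auto intro: has_value_at_infinity_add)

lemma has_value_at_infinity_prod:
  "(\<And>i. i \<in> A \<Longrightarrow> has_value_at_infinity (f i) (c i)) \<Longrightarrow> has_value_at_infinity (prod f A) (prod c A)"
  by (induction A rule: infinite_finite_induct) (auto intro: has_value_at_infinity_mult)

lemma has_value_at_infinity_minus_1: "has_value_at_infinity (- 1) (- 1)"
proof -
  have "const_ratfun (- 1) = to_fract (- 1)"
    unfolding const_ratfun_def by (simp add: one_pCons del: to_fract_uminus)
  then have "const_ratfun (- 1) = - 1" by simp
  then show ?thesis using has_value_at_infinity_const[of "- 1"] by simp
qed

lemma has_value_at_infinity_det:
  fixes A :: "ratfun ^ 'n ^ 'n" and C :: "complex ^ 'n ^ 'n"
  assumes "\<And>i j. has_value_at_infinity (A $ i $ j) (C $ i $ j)"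
  shows "has_value_at_infinity (det A) (det C)"
proof -
  have "has_value_at_infinity (of_int (sign p)) (of_int (sign p))" for p :: "'n \<Rightarrow> 'n"
    using has_value_at_infinity_minus_1 by (simp add: sign_def)
  then show ?thesis
    unfolding det_def
    by (intro has_value_at_infinity_sum has_value_at_infinity_mult has_value_at_infinity_prod assms)
qed

text \<open>Hence inverses, and thus \<open>generate\<close>, have their usual meaning in \<open>rational_loop_group\<close>.\<close>

lemma group_rational_loop_group: "group (rational_loop_group :: (ratfun ^ 'n ^ 'n) monoid)"
proof (rule groupI)
  let ?G = "rational_loop_group :: (ratfun ^ 'n ^ 'n) monoid"
  show "x \<otimes>\<^bsub>?G\<^esub> y \<in> carrier ?G" if "x \<in> carrier ?G" "y \<in> carrier ?G" for x y
  proof -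
    have "has_value_at_infinity ((x ** y) $ i $ j) ((mat 1 ** mat 1 :: complex ^ 'n ^ 'n) $ i $ j)" for i j
      unfolding matrix_matrix_mult_def using that
      by (auto simp: rational_loop_group_def intro!: has_value_at_infinity_sum has_value_at_infinity_mult)
    then show ?thesis using that by (simp add: rational_loop_group_def det_mul)
  qed
  show "\<one>\<^bsub>?G\<^esub> \<in> carrier ?G"
  proof -
    have "has_value_at_infinity ((mat 1 :: ratfun ^ 'n ^ 'n) $ i $ j) ((mat 1 :: complex ^ 'n ^ 'n) $ i $ j)" for i j
      by (simp add: mat_def)
    then show ?thesis by (simp add: rational_loop_group_def)
  qed
  show "x \<otimes>\<^bsub>?G\<^esub> y \<otimes>\<^bsub>?G\<^esub> z = x \<otimes>\<^bsub>?G\<^esub> (y \<otimes>\<^bsub>?G\<^esub> z)" for x y z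
    by (simp add: rational_loop_group_def matrix_mul_assoc)
  show "\<one>\<^bsub>?G\<^esub> \<otimes>\<^bsub>?G\<^esub> x = x" for x
    by (simp add: rational_loop_group_def)
  show "\<exists>y\<in>carrier ?G. y \<otimes>\<^bsub>?G\<^esub> x = \<one>\<^bsub>?G\<^esub>" if "x \<in> carrier ?G" for x
  proof -
    have d: "det x \<noteq> 0" and v: "\<And>i j. has_value_at_infinity (x $ i $ j) ((mat 1 :: complex ^ 'n ^ 'n) $ i $ j)"
      using that by (auto simp: rational_loop_group_def)
    obtain y where yx: "y ** x = mat 1" and xy: "x ** y = mat 1"
      using d invertible_det_nz[of x] unfolding invertible_def by blast
    have dy: "det y \<noteq> 0"
      using arg_cong[OF yx, of det] by (auto simp: det_mul)
    have dinv: "has_value_at_infinity (inverse (det x)) 1"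
      using has_value_at_infinity_inverse[OF has_value_at_infinity_det[OF v]] by simp
    have "has_value_at_infinity (y $ i $ j) ((mat 1 :: complex ^ 'n ^ 'n) $ i $ j)" for i j
    proof -
      let ?X = "\<chi> i' l. if l = i then axis j 1 $ i' else x $ i' $ l"
      let ?I = "\<chi> i' l. if l = i then axis j 1 $ i' else (mat 1 :: complex ^ 'n ^ 'n) $ i' $ l"
      have "x *v (y *v axis j 1) = axis j 1" by (simp add: matrix_vector_mul_assoc xy)
      then have "det ?X = (y *v axis j 1) $ i * det x"
        using cramer_lemma[where A = x and x = "y *v axis j 1" and k = i] by (simp only:)
      moreover have "(y *v axis j 1) $ i = y $ i $ j"
        by (simp add: matrix_vector_mult_def axis_def if_distrib cong: if_cong)
      ultimately have yij: "y $ i $ j = det ?X * inverse (det x)"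
        using d by simp
      have "(axis j 1 :: complex ^ 'n) $ i = det ?I"
        using cramer_lemma[where A = "mat 1 :: complex ^ 'n ^ 'n" and x = "axis j 1" and k = i]
        by (simp only: matrix_vector_mul_lid det_I mult_1_right)
      moreover have "(axis j 1 :: complex ^ 'n) $ i = (mat 1 :: complex ^ 'n ^ 'n) $ i $ j"
        by (simp add: axis_def mat_def)
      moreover have "has_value_at_infinity (det ?X) (det ?I)"
        by (rule has_value_at_infinity_det) (use v in \<open>auto simp: axis_def\<close>)
      ultimately show ?thesis
        using has_value_at_infinity_mult[OF _ dinv] yij by simp
    qed
    then show ?thesis using yx dy by (auto simp: rational_loop_group_def intro!: bexI[of _ y])
  qed
qed

end

theory Submission
  imports Defs "HOL-Computational_Algebra.Fundamental_Theorem_Algebra"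
begin

text \<open>The rational functions that are regular at infinity form a local ring, and the loops are the
  invertible matrices over it that are congruent to the identity modulo its maximal ideal. Gaussian
  elimination therefore needs no pivoting: a loop is a product of matrices that differ from the
  identity in a single row. Each of these is a product of diagonal matrices and of transvections
  \<open>I + f E\<^sub>k\<^sub>j\<close> with \<open>f(\<infinity>) = 0\<close>. For every constant idempotent \<open>A\<close> and every \<open>u\<close> with
  \<open>u(\<infinity>) = 1\<close>, the loop \<open>u A + (I - A)\<close> is a product of projective loops, because \<open>u\<close> is a product
  of factors \<open>(\<lambda> - \<alpha>) / (\<lambda> - \<beta>)\<close>. With \<open>A = E\<^sub>k\<^sub>k\<close> this yields the diagonal matrices. With
  \<open>A = E\<^sub>k\<^sub>k - E\<^sub>k\<^sub>j\<close> and \<open>u = 1 - f\<close> it yields the transvection up to a diagonal factor.\<close>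

section \<open>Constants and values at infinity\<close>

lemma const_ratfun_0 [simp]: "const_ratfun 0 = 0"
  and const_ratfun_1 [simp]: "const_ratfun 1 = 1"
  by (simp_all add: const_ratfun_def flip: one_pCons)

lemma const_ratfun_add: "const_ratfun (a + b) = const_ratfun a + const_ratfun b"
  by (simp add: const_ratfun_def flip: to_fract_add)

lemma const_ratfun_diff: "const_ratfun (a - b) = const_ratfun a - const_ratfun b"
  by (simp add: const_ratfun_def flip: to_fract_diff)

lemma const_ratfun_minus: "const_ratfun (- a) = - const_ratfun a"
  using const_ratfun_diff[of 0 a] by simp

lemma const_ratfun_mult: "const_ratfun (a * b) = const_ratfun a * const_ratfun b"
  by (simp add: const_ratfun_def flip: to_fract_mult)

lemma const_ratfun_sum: "const_ratfun (sum f A) = (\<Sum>x\<in>A. const_ratfun (f x))"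
  by (induction A rule: infinite_finite_induct) (simp_all add: const_ratfun_add)

lemma has_value_at_infinity_diff:
  assumes "has_value_at_infinity f c" "has_value_at_infinity g d"
  shows "has_value_at_infinity (f - g) (c - d)"
  using has_value_at_infinity_add[OF assms(1) has_value_at_infinity_mult[OF has_value_at_infinity_minus_1 assms(2)]]
  by simp

text \<open>Unequal degrees would make the quotient or its reciprocal tend to 0, and for equal
  degrees the limit is the ratio of the leading coefficients. This is what allows numerator and
  denominator to be split into equally many linear factors with no scalar left over.\<close>

lemma tendsto_poly_divide_at_infinity_1:
  fixes p q :: "complex poly"
  assumes "q \<noteq> 0" and lim: "((\<lambda>z. poly p z / poly q z) \<longlongrightarrow> 1) at_infinity"
  shows "degree p = degree q \<and> lead_coeff p = lead_coeff q"
proof -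
  have "\<not> degree p < degree q"
    using poly_divide_tendsto_0_at_infinity[of p q] tendsto_unique[OF trivial_limit_at_infinity lim, of 0]
    by auto
  moreover have "\<not> degree q < degree p"
    using poly_divide_tendsto_0_at_infinity[of q p] tendsto_inverse[OF lim]
      tendsto_unique[OF trivial_limit_at_infinity, of "\<lambda>z. poly q z / poly p z" 0 1]
    by auto
  ultimately have deg: "degree p = degree q" by simp
  have "((\<lambda>z. (poly p z / z ^ degree p) / (poly q z / z ^ degree q)) \<longlongrightarrow> lead_coeff p / lead_coeff q) at_infinity"
    using assms(1) by (intro tendsto_divide poly_divide_tendsto_aux) simp
  moreover have "eventually (\<lambda>z. (poly p z / z ^ degree p) / (poly q z / z ^ degree q) = poly p z / poly q z) at_infinity"
    by (rule eventually_at_infinityI[of 1]) (auto simp: deg)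
  ultimately have "((\<lambda>z. poly p z / poly q z) \<longlongrightarrow> lead_coeff p / lead_coeff q) at_infinity"
    by (rule Lim_transform_eventually)
  then have "lead_coeff p / lead_coeff q = 1"
    using tendsto_unique[OF trivial_limit_at_infinity _ lim] by blast
  then show ?thesis using deg assms(1) by simp
qed

lemma has_value_at_infinity_linear_quotient:
  "has_value_at_infinity (to_fract [:- \<alpha>, 1:] / to_fract [:- \<beta>, 1:]) 1"
proof -
  \<comment> \<open>The quotient is 1 plus (\<beta> - \<alpha>) / (\<lambda> - \<beta>), and the
    second term vanishes at infinity.\<close>
  have "((\<lambda>z. poly [:\<beta> - \<alpha>:] z / poly [:- \<beta>, 1:] z) \<longlongrightarrow> 0) at_infinity"
    by (rule poly_divide_tendsto_0_at_infinity) simp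
  then have "has_value_at_infinity (to_fract [:\<beta> - \<alpha>:] / to_fract [:- \<beta>, 1:]) 0"
    by (subst value_at_infinity_representation) simp_all
  from has_value_at_infinity_add[OF has_value_at_infinity_1 this]
  have "has_value_at_infinity (1 + to_fract [:\<beta> - \<alpha>:] / to_fract [:- \<beta>, 1:]) 1"
    by simp
  moreover have "1 + to_fract [:\<beta> - \<alpha>:] / to_fract [:- \<beta>, 1:] = to_fract [:- \<alpha>, 1:] / to_fract [:- \<beta>, 1:]"
    by (simp add: add_divide_eq_iff flip: to_fract_add)
  ultimately show ?thesis by simp
qed

section \<open>Loops attached to an idempotent matrix\<close>

definition idempotent_loop :: "complex ^ 'n ^ 'n \<Rightarrow> ratfun \<Rightarrow> ratfun ^ 'n ^ 'n" where
  "idempotent_loop A u = (\<chi> i j. u * const_ratfun (A $ i $ j) + const_ratfun ((mat 1 - A) $ i $ j))"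

lemma idempotent_loop_nth:
  "idempotent_loop A u $ i $ j = (if i = j then 1 else 0) + (u - 1) * const_ratfun (A $ i $ j)"
  by (simp add: idempotent_loop_def mat_def const_ratfun_diff algebra_simps)

lemma idempotent_loop_1: "idempotent_loop A 1 = mat 1"
  by (simp add: vec_eq_iff idempotent_loop_nth mat_def)

text \<open>The loop is \<open>I + (u - 1) A\<close>. As \<open>A\<close> is idempotent, the
  coefficient of \<open>A\<close> in the product is (u - 1) + (v - 1) + (u - 1)(v - 1) = u v - 1.
  Factorizations of \<open>u\<close> thus become factorizations of the loop.\<close>

lemma idempotent_loop_mult:
  assumes "A ** A = A"
  shows "idempotent_loop A u ** idempotent_loop A v = idempotent_loop A (u * v)"
proof -
  have A: "(\<Sum>k\<in>UNIV. const_ratfun (A $ i $ k) * const_ratfun (A $ k $ j)) = const_ratfun (A $ i $ j)" for i j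
    using arg_cong[OF assms, of "\<lambda>B. const_ratfun (B $ i $ j)"]
    by (simp add: matrix_matrix_mult_def const_ratfun_sum const_ratfun_mult)
  have "(idempotent_loop A u ** idempotent_loop A v) $ i $ j = idempotent_loop A (u * v) $ i $ j" for i j
  proof -
    have "(idempotent_loop A u ** idempotent_loop A v) $ i $ j
        = (\<Sum>k\<in>UNIV. (if i = k then (if k = j then 1 else 0) else 0)
            + (if i = k then (v - 1) * const_ratfun (A $ k $ j) else 0)
            + (if k = j then (u - 1) * const_ratfun (A $ i $ k) else 0)
            + (u - 1) * (v - 1) * (const_ratfun (A $ i $ k) * const_ratfun (A $ k $ j)))"
      unfolding matrix_matrix_mult_def
      by (simp add: idempotent_loop_nth) (rule sum.cong, auto simp: algebra_simps)
    also have "\<dots> = (if i = j then 1 else 0) + (v - 1) * const_ratfun (A $ i $ j)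
        + (u - 1) * const_ratfun (A $ i $ j) + (u - 1) * (v - 1) * const_ratfun (A $ i $ j)"
      by (simp add: sum.distrib A flip: sum_distrib_left)
    also have "\<dots> = idempotent_loop A (u * v) $ i $ j"
      by (simp add: idempotent_loop_nth algebra_simps)
    finally show ?thesis .
  qed
  then show ?thesis by (simp add: vec_eq_iff)
qed

text \<open>The loop for \<open>inverse u\<close> is an inverse, so the determinant cannot vanish.
  At infinity the entries become those of \<open>A + (I - A)\<close>.\<close>

lemma idempotent_loop_in_carrier:
  assumes "A ** A = A" "has_value_at_infinity u 1"
  shows "idempotent_loop A u \<in> carrier rational_loop_group"
proof -
  have "u \<noteq> 0"
    using assms(2) value_at_infinity_unique[of 0 0 1] by auto
  then have "idempotent_loop A u ** idempotent_loop A (inverse u) = mat 1"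
    by (simp add: idempotent_loop_mult[OF assms(1)] idempotent_loop_1)
  from arg_cong[OF this, of det] have "det (idempotent_loop A u) \<noteq> 0"
    by (auto simp: det_mul)
  moreover have "has_value_at_infinity (idempotent_loop A u $ i $ j) ((mat 1 :: complex ^ 'a ^ 'a) $ i $ j)" for i j
    using has_value_at_infinity_add[OF has_value_at_infinity_mult[OF assms(2) has_value_at_infinity_const[of "A $ i $ j"]]
        has_value_at_infinity_const[of "(mat 1 - A) $ i $ j"]]
    by (simp add: idempotent_loop_def)
  ultimately show ?thesis by (simp add: rational_loop_group_def)
qed

section \<open>Decompositions of the space and idempotent matrices\<close>

lemma complementary_sym:
  assumes "complementary V W"
  shows "complementary W V"
proof -
  have "{w + v | w v. w \<in> W \<and> v \<in> V} = {v + w | v w. v \<in> V \<and> w \<in> W}"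
    by (metis (no_types, lifting) add.commute)
  then show ?thesis
    using assms by (simp add: complementary_def Int_commute)
qed

text \<open>Two candidates differ by an element of both \<open>V\<close> and \<open>W\<close>, hence
  by 0. Later facts about \<open>proj_along\<close> come from exhibiting a candidate.\<close>

lemma proj_along_eq:
  assumes "complementary V W" "v \<in> V" "x - v \<in> W"
  shows "proj_along V W x = v"
  unfolding proj_along_def
proof (rule the_equality)
  fix v' assume v': "v' \<in> V \<and> x - v' \<in> W"
  have "v' - v \<in> V"
    using assms v' by (auto simp: complementary_def intro: vec.subspace_diff)
  moreover have "(x - v) - (x - v') \<in> W"
    using assms v' unfolding complementary_def by (blast intro: vec.subspace_diff[of W "x - v" "x - v'"])
  ultimately have "v' - v \<in> V \<inter> W" by simp
  also have "V \<inter> W = {0}" using assms(1) by (simp add: complementary_def)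
  finally show "v' = v" by simp
qed (use assms in simp)

lemma proj_along_mem:
  assumes "complementary V W"
  shows "proj_along V W x \<in> V" "x - proj_along V W x \<in> W"
proof -
  have "x \<in> {v + w | v w. v \<in> V \<and> w \<in> W}"
    using assms by (simp add: complementary_def)
  then obtain v w where "x = v + w" "v \<in> V" "w \<in> W" by blast
  then show "proj_along V W x \<in> V" "x - proj_along V W x \<in> W"
    using proj_along_eq[OF assms, of v x] by auto
qed

lemma proj_along_swap:
  assumes "complementary V W"
  shows "proj_along W V x = x - proj_along V W x"
  by (rule proj_along_eq[OF complementary_sym[OF assms]]) (simp_all add: proj_along_mem[OF assms])

lemma linear_proj_along:
  assumes "complementary V W"
  shows "Vector_Spaces.linear (*s) (*s) (proj_along V W)"
proof
  have sub: "vec.subspace V" "vec.subspace W"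
    using assms by (auto simp: complementary_def)
  note mem = proj_along_mem[OF assms]
  show "proj_along V W (x + y) = proj_along V W x + proj_along V W y" for x y
    using vec.subspace_add[OF sub(2) mem(2)[of x] mem(2)[of y]]
    by (intro proj_along_eq assms vec.subspace_add sub mem) (simp add: algebra_simps)
  show "proj_along V W (c *s x) = c *s proj_along V W x" for c x
    using vec.subspace_scale[OF sub(2) mem(2)[of x], of c]
    by (intro proj_along_eq assms vec.subspace_scale sub mem) simp
qed

lemma proj_along_matrix:
  assumes "complementary V W"
  shows "matrix (proj_along V W) ** matrix (proj_along V W) = matrix (proj_along V W)"
    and "matrix (proj_along W V) = mat 1 - matrix (proj_along V W)"
proof -
  have "proj_along V W (proj_along V W x) = proj_along V W x" for x
    using assms by (intro proj_along_eq)
      (auto simp: proj_along_mem complementary_def intro: vec.subspace_0)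
  then have "(matrix (proj_along V W) ** matrix (proj_along V W)) *v x = matrix (proj_along V W) *v x" for x
    unfolding matrix_vector_mul_assoc[symmetric] matrix_works[OF linear_proj_along[OF assms]] .
  then show "matrix (proj_along V W) ** matrix (proj_along V W) = matrix (proj_along V W)"
    unfolding matrix_eq by blast
  show "matrix (proj_along W V) = mat 1 - matrix (proj_along V W)"
    by (simp add: vec_eq_iff matrix_def proj_along_swap[OF assms] mat_def axis_def)
qed

lemma projective_loop_eq_idempotent_loop:
  assumes "complementary V W"
  shows "projective_loop \<alpha> \<beta> V W
           = idempotent_loop (matrix (proj_along V W)) (to_fract [:- \<alpha>, 1:] / to_fract [:- \<beta>, 1:])"
  unfolding projective_loop_def idempotent_loop_def proj_along_matrix(2)[OF assms] ..

lemma projective_loops_subset: "(projective_loops :: (ratfun ^ 'n ^ 'n) set) \<subseteq> carrier rational_loop_group"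
proof
  fix g :: "ratfun ^ 'n ^ 'n"
  assume "g \<in> projective_loops"
  then obtain \<alpha> \<beta> V W where "g = projective_loop \<alpha> \<beta> V W" and VW: "complementary V W"
    unfolding projective_loops_def by blast
  then show "g \<in> carrier rational_loop_group"
    by (simp only: projective_loop_eq_idempotent_loop[OF VW]
        idempotent_loop_in_carrier[OF proj_along_matrix(1)[OF VW] has_value_at_infinity_linear_quotient])
qed

text \<open>The decomposition is x = A x + (x - A x). With this converse of
  \<open>proj_along_matrix\<close>, generators can be chosen by writing down idempotent matrices
  instead of subspaces.\<close>

lemma idempotent_matrix_projection:
  fixes A :: "complex ^ 'n ^ 'n"
  assumes "A ** A = A"
  defines "V \<equiv> range ((*v) A)" and "W \<equiv> {x. A *v x = 0}"
  shows "complementary V W" and "matrix (proj_along V W) = A"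
proof -
  have AA: "A *v (A *v x) = A *v x" for x
    by (simp add: matrix_vector_mul_assoc assms(1))
  have "x \<in> {v + w | v w. v \<in> V \<and> w \<in> W}" for x
  proof (intro CollectI exI conjI)
    show "x = A *v x + (x - A *v x)" by simp
    show "A *v x \<in> V" by (simp add: V_def)
    show "x - A *v x \<in> W" by (simp add: W_def matrix_vector_mult_diff_distrib AA)
  qed
  moreover have "vec.subspace V"
    unfolding V_def
  proof (rule vec.subspaceI)
    show "0 \<in> range ((*v) A)"
      by (rule range_eqI[of _ _ 0]) simp
    show "x + y \<in> range ((*v) A)" if xy: "x \<in> range ((*v) A)" "y \<in> range ((*v) A)" for x y
    proof -
      obtain a b where "x = A *v a" "y = A *v b" using xy by blast
      then have "x + y = A *v (a + b)" by (simp add: matrix_vector_right_distrib)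
      then show ?thesis by (rule range_eqI)
    qed
    show "c *s x \<in> range ((*v) A)" if x: "x \<in> range ((*v) A)" for c x
    proof -
      obtain a where "x = A *v a" using x by blast
      then have "c *s x = A *v (c *s a)" by (simp add: vec.scale)
      then show ?thesis by (rule range_eqI)
    qed
  qed
  moreover have "vec.subspace W"
    unfolding W_def
    by (rule vec.subspaceI) (auto simp: matrix_vector_right_distrib vec.scale)
  moreover have "V \<inter> W = {0}"
    using range_eqI[of 0 "(*v) A" 0] by (auto simp: V_def W_def AA)
  ultimately show comp: "complementary V W"
    by (auto simp: complementary_def)
  have "proj_along V W x = A *v x" for x
    by (rule proj_along_eq[OF comp]) (auto simp: V_def W_def matrix_vector_mult_diff_distrib AA)
  then have "proj_along V W = (*v) A" by blast
  then show "matrix (proj_along V W) = A"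
    by simp
qed

section \<open>The group generated by the projective loops\<close>

abbreviation projective_group :: "(ratfun ^ 'n ^ 'n) set" where
  "projective_group \<equiv> generate rational_loop_group projective_loops"

lemma projective_group_mult: "a \<in> projective_group \<Longrightarrow> b \<in> projective_group \<Longrightarrow> a ** b \<in> projective_group"
  using generate.eng[of a rational_loop_group projective_loops b] by (simp add: rational_loop_group_def)

lemma projective_group_1: "mat 1 \<in> projective_group"
  using generate.one[of rational_loop_group projective_loops] by (simp add: rational_loop_group_def)

lemma idempotent_loop_in_projective_group:
  fixes A :: "complex ^ 'n ^ 'n"
  assumes A: "A ** A = A" and u: "has_value_at_infinity u 1"
  shows "idempotent_loop A u \<in> projective_group"
proof -
  \<comment> \<open>The polynomials factored below need not be coprime, so \<alpha> = \<beta> can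
    occur. The generators exclude this case, but the factor is then the identity.\<close>
  have linear: "idempotent_loop A (to_fract [:- \<alpha>, 1:] / to_fract [:- \<beta>, 1:]) \<in> projective_group" for \<alpha> \<beta>
  proof (cases "\<alpha> = \<beta>")
    case True
    then show ?thesis by (simp add: idempotent_loop_1 projective_group_1)
  next
    case False
    note V = idempotent_matrix_projection[OF A]
    have "idempotent_loop A (to_fract [:- \<alpha>, 1:] / to_fract [:- \<beta>, 1:])
        = projective_loop \<alpha> \<beta> (range ((*v) A)) {x. A *v x = 0}"
      by (simp only: projective_loop_eq_idempotent_loop[OF V(1)] V(2))
    then have "idempotent_loop A (to_fract [:- \<alpha>, 1:] / to_fract [:- \<beta>, 1:]) \<in> projective_loops"
      unfolding projective_loops_def using False V(1) by (intro CollectI exI conjI)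
    then show ?thesis by (rule generate.incl)
  qed
  have split: "\<exists>a p'. p = [:- a, 1:] * p'" if p: "degree p \<noteq> 0" for p :: "complex poly"
  proof -
    obtain a where "poly p a = 0"
      using alg_closed_imp_poly_has_root[of p] p by auto
    then show ?thesis by (auto simp: poly_eq_0_iff_dvd dvd_def)
  qed
  \<comment> \<open>Induction on the common degree: one root of each polynomial is split off, which
    keeps degrees and leading coefficients equal. In degree 0 the two polynomials coincide.\<close>
  have "idempotent_loop A (to_fract p / to_fract q) \<in> projective_group"
    if "degree p = d" "degree q = d" "lead_coeff p = lead_coeff q" "q \<noteq> 0" for p q d
    using that
  proof (induction d arbitrary: p q)
    case 0
    then have "p = q" by (metis degree_0_id)
    then show ?case using 0 by (simp add: idempotent_loop_1 projective_group_1)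
  next
    case (Suc d)
    obtain a p' b q' where p: "p = [:- a, 1:] * p'" and q: "q = [:- b, 1:] * q'"
      using split[of p] split[of q] Suc.prems by auto
    have "p' \<noteq> 0" "q' \<noteq> 0" using Suc.prems p q by auto
    have deg: "degree ([:- c, 1:] * r) = Suc (degree r)" if "r \<noteq> 0" for c and r :: "complex poly"
      using that by (subst degree_mult_eq) simp_all
    have "lead_coeff ([:- c, 1:] * r) = lead_coeff r" for c and r :: "complex poly"
      unfolding lead_coeff_mult by simp
    then have "degree p' = d" "degree q' = d" "lead_coeff p' = lead_coeff q'"
      using Suc.prems deg \<open>p' \<noteq> 0\<close> \<open>q' \<noteq> 0\<close> unfolding p q by (metis nat.inject)+
    then have "idempotent_loop A (to_fract p' / to_fract q') \<in> projective_group"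
      using \<open>q' \<noteq> 0\<close> by (rule Suc.IH)
    from projective_group_mult[OF linear[of a b] this] show ?case
      by (simp add: idempotent_loop_mult[OF A] p q del: mult_pCons_left)
  qed
  moreover obtain p q where "q \<noteq> 0" "u = to_fract p / to_fract q"
    "((\<lambda>z. poly p z / poly q z) \<longlongrightarrow> 1) at_infinity"
    using u unfolding has_value_at_infinity_def by blast
  ultimately show ?thesis
    using tendsto_poly_divide_at_infinity_1 by metis
qed

section \<open>Matrices that differ from the identity in one row\<close>

definition row_matrix :: "'n \<Rightarrow> ('n \<Rightarrow> 'a) \<Rightarrow> 'a::zero_neq_one ^ 'n ^ 'n" where
  "row_matrix k v = (\<chi> i j. if i = k then v j else if i = j then 1 else 0)"

lemma mult_row_matrix_nth:
  fixes g :: "'a::comm_ring_1 ^ 'n ^ 'm"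
  shows "(g ** row_matrix k v) $ i $ j = g $ i $ k * v j + (if j = k then 0 else g $ i $ j)"
proof -
  have "(g ** row_matrix k v) $ i $ j
      = (\<Sum>l\<in>UNIV. (if l = k then g $ i $ l * v j else 0) + (if l = j then (if j = k then 0 else g $ i $ l) else 0))"
    unfolding matrix_matrix_mult_def row_matrix_def
    by simp (rule sum.cong, auto)
  then show ?thesis by (simp add: sum.distrib)
qed

text \<open>All rows other than \<open>k\<close> stay those of the identity, so factorizations with
  a common \<open>k\<close> can be checked on row \<open>k\<close> alone.\<close>

lemma row_matrix_mult:
  "row_matrix k v ** row_matrix k w = row_matrix k (\<lambda>j. v k * w j + (if j = k then 0 else v j :: 'a::comm_ring_1))"
  unfolding vec_eq_iff mult_row_matrix_nth by (simp add: row_matrix_def)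

lemma diagonal_in_projective_group:
  fixes k :: "'n::finite"
  assumes "has_value_at_infinity u 1"
  shows "row_matrix k (\<lambda>j. if j = k then u else 0) \<in> projective_group"
proof -
  let ?A = "(\<chi> i j. if i = k \<and> j = k then 1 else 0) :: complex ^ 'n ^ 'n"
  have "(\<Sum>l\<in>UNIV. ?A $ i $ l * ?A $ l $ j) = (\<Sum>l\<in>UNIV. if l = k then ?A $ i $ l * ?A $ l $ j else 0)" for i j
    by (rule sum.cong) auto
  then have "?A ** ?A = ?A"
    by (simp add: vec_eq_iff matrix_matrix_mult_def)
  moreover have "row_matrix k (\<lambda>j. if j = k then u else 0) = idempotent_loop ?A u"
    by (auto simp: vec_eq_iff row_matrix_def idempotent_loop_nth)
  ultimately show ?thesis
    using idempotent_loop_in_projective_group assms by metis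
qed

lemma transvection_in_projective_group:
  fixes k :: "'n::finite"
  assumes f: "has_value_at_infinity f 0" and "j \<noteq> k"
  shows "row_matrix k (\<lambda>l. if l = k then 1 else if l = j then f else 0) \<in> projective_group"
proof -
  let ?A = "(\<chi> i l. if i = k then (if l = k then 1 else if l = j then - 1 else 0) else 0) :: complex ^ 'n ^ 'n"
  define u where "u = 1 - f"
  have u: "has_value_at_infinity u 1"
    using has_value_at_infinity_diff[OF has_value_at_infinity_1 f] by (simp add: u_def)
  have "u \<noteq> 0"
    using u value_at_infinity_unique[of 0 0 1] by auto
  \<comment> \<open>Only \<open>l = k\<close> contributes, since all other rows of \<open>?A\<close>
    are zero.\<close>
  have "(\<Sum>l\<in>UNIV. ?A $ i $ l * ?A $ l $ m) = (\<Sum>l\<in>UNIV. if l = k then ?A $ i $ l * ?A $ l $ m else 0)" for i m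
    by (rule sum.cong) auto
  then have "?A ** ?A = ?A"
    by (simp add: vec_eq_iff matrix_matrix_mult_def)
  then have "idempotent_loop ?A u \<in> projective_group"
    using u by (rule idempotent_loop_in_projective_group)
  \<comment> \<open>The entry at \<open>j\<close> is -(u - 1) = f, which explains the sign in
    \<open>?A\<close> and the choice of \<open>u\<close>.\<close>
  moreover have "idempotent_loop ?A u = row_matrix k (\<lambda>l. if l = k then u else if l = j then f else 0)"
    using \<open>j \<noteq> k\<close> by (auto simp: vec_eq_iff row_matrix_def idempotent_loop_nth u_def const_ratfun_minus)
  \<comment> \<open>Placed on the right, this factor rescales column \<open>k\<close> only: it turns
    \<open>u\<close> into 1 and leaves \<open>f\<close> alone.\<close>
  moreover have "row_matrix k (\<lambda>l. if l = k then inverse u else 0) \<in> projective_group"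
    using has_value_at_infinity_inverse[OF u] by (intro diagonal_in_projective_group) simp
  ultimately have "row_matrix k (\<lambda>l. if l = k then u else if l = j then f else 0)
      ** row_matrix k (\<lambda>l. if l = k then inverse u else 0) \<in> projective_group"
    by (intro projective_group_mult) simp_all
  also have "row_matrix k (\<lambda>l. if l = k then u else if l = j then f else 0)
      ** row_matrix k (\<lambda>l. if l = k then inverse u else 0)
      = row_matrix k (\<lambda>l. if l = k then 1 else if l = j then f else 0)"
    unfolding row_matrix_mult using \<open>u \<noteq> 0\<close> by (intro arg_cong[of _ _ "row_matrix k"] ext) simp
  finally show ?thesis .
qed

lemma row_matrix_in_projective_group:
  assumes k: "has_value_at_infinity (v k) 1"
    and v: "\<And>j. j \<noteq> k \<Longrightarrow> has_value_at_infinity (v j) 0"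
  shows "row_matrix k v \<in> projective_group"
proof -
  \<comment> \<open>With 1 in position \<open>k\<close> of both factors, the other entries of row
    \<open>k\<close> simply add, so one transvection is used per element of
    \<open>J\<close>.\<close>
  have unipotent: "row_matrix k (\<lambda>l. if l = k then 1 else if l \<in> J then v l else 0) \<in> projective_group"
    if "finite J" "k \<notin> J" for J
    using that
  proof (induction J)
    case empty
    then show ?case using diagonal_in_projective_group[of 1 k] by (simp cong: if_cong)
  next
    case (insert j J)
    then have "row_matrix k (\<lambda>l. if l = k then 1 else if l = j then v j else 0)
        ** row_matrix k (\<lambda>l. if l = k then 1 else if l \<in> J then v l else 0) \<in> projective_group"
      by (intro projective_group_mult transvection_in_projective_group v) auto
    also have "row_matrix k (\<lambda>l. if l = k then 1 else if l = j then v j else 0)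
        ** row_matrix k (\<lambda>l. if l = k then 1 else if l \<in> J then v l else 0)
        = row_matrix k (\<lambda>l. if l = k then 1 else if l \<in> insert j J then v l else 0)"
      unfolding row_matrix_mult using insert
      by (intro arg_cong[of _ _ "row_matrix k"] ext) auto
    finally show ?case .
  qed
  \<comment> \<open>The order matters: on the left, the diagonal factor would multiply the whole row
    by \<open>v k\<close>.\<close>
  have "row_matrix k (\<lambda>l. if l = k then 1 else if l \<in> - {k} then v l else 0)
      ** row_matrix k (\<lambda>l. if l = k then v k else 0) \<in> projective_group"
    by (intro projective_group_mult unipotent diagonal_in_projective_group k) auto
  also have "row_matrix k (\<lambda>l. if l = k then 1 else if l \<in> - {k} then v l else 0)
      ** row_matrix k (\<lambda>l. if l = k then v k else 0) = row_matrix k v"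
    unfolding row_matrix_mult by (intro arg_cong[of _ _ "row_matrix k"] ext) auto
  finally show ?thesis .
qed

section \<open>Gaussian elimination\<close>

lemma loop_in_projective_group:
  fixes g :: "ratfun ^ 'n ^ 'n"
  assumes "finite S" "g \<in> carrier rational_loop_group"
    and "\<And>i j. i \<notin> S \<Longrightarrow> g $ i $ j = (if i = j then 1 else 0)"
  shows "g \<in> projective_group"
  using assms
\<comment> \<open>\<open>S\<close> collects the rows not yet known to be rows of the identity. Each
  step removes one of them.\<close>
proof (induction S arbitrary: g)
  case empty
  then have "g = mat 1" by (simp add: vec_eq_iff mat_def)
  then show ?case by (simp add: projective_group_1)
next
  case (insert k T)
  interpret group "rational_loop_group :: (ratfun ^ 'n ^ 'n) monoid"
    by (rule group_rational_loop_group)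
  let ?G = "rational_loop_group :: (ratfun ^ 'n ^ 'n) monoid"
  define M where "M = row_matrix k (($) (g $ k))"
  have val: "has_value_at_infinity (g $ i $ j) (if i = j then 1 else 0)" for i j
    using insert.prems(1) by (auto simp: rational_loop_group_def mat_def)
  have M: "M \<in> projective_group"
    unfolding M_def using val[of k] by (intro row_matrix_in_projective_group) (metis+)
  then have Mc: "M \<in> carrier ?G"
    using generate_incl[OF projective_loops_subset] by blast
  \<comment> \<open>Right division by \<open>M\<close> clears row \<open>k\<close>. Since g = g' M,
    only \<open>M\<close> itself has to be a product of projective loops.\<close>
  define g' where "g' = g \<otimes>\<^bsub>?G\<^esub> inv\<^bsub>?G\<^esub> M"
  have g'c: "g' \<in> carrier ?G"
    using insert.prems(1) Mc by (simp add: g'_def)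
  have "g = g' \<otimes>\<^bsub>?G\<^esub> M"
    using insert.prems(1) Mc by (simp add: g'_def m_assoc)
  then have g: "g = g' ** M" by (simp add: rational_loop_group_def)
  \<comment> \<open>The pivot is nonzero because its value at infinity is 1.\<close>
  have nz: "g $ k $ k \<noteq> 0"
    using val[of k k] value_at_infinity_unique[of 0 0 1] by auto
  have "g' $ i $ j = (if i = j then 1 else 0)" if "i \<notin> T" for i j
  proof -
    \<comment> \<open>Taking \<open>l = k\<close> gives the entry of \<open>g'\<close> in column
      \<open>k\<close> as \<open>g $ i $ k\<close> divided by the pivot. This is 1 for
      \<open>i = k\<close> and 0 for a row finished earlier, and the remaining entries
      follow.\<close>
    have eq: "g $ i $ l = g' $ i $ k * g $ k $ l + (if l = k then 0 else g' $ i $ l)" for l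
      using mult_row_matrix_nth[of g' k "($) (g $ k)" i l] by (simp add: g[symmetric] flip: M_def)
    show ?thesis
    proof (cases "i = k")
      case True
      then have "g' $ i $ k = 1" using eq[of k] nz by simp
      then show ?thesis using eq[of j] True by (auto split: if_splits)
    next
      case False
      then have gi: "g $ i $ l = (if i = l then 1 else 0)" for l
        using insert.prems(2)[of i l] that by simp
      then have "g' $ i $ k = 0" using eq[of k] nz False by simp
      then show ?thesis using eq[of j] gi[of j] False by (auto split: if_splits)
    qed
  qed
  then have "g' \<in> projective_group"
    by (intro insert.IH g'c) auto
  then show ?case
    using M g projective_group_mult by blast
qed

theorem theorem2p3:
  shows "generate (rational_loop_group :: (ratfun ^ 'n ^ 'n) monoid) projective_loops
           = carrier rational_loop_group"
proof
  show "generate (rational_loop_group :: (ratfun ^ 'n ^ 'n) monoid) projective_loops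
      \<subseteq> carrier rational_loop_group"
    by (rule group.generate_incl[OF group_rational_loop_group projective_loops_subset])
  show "carrier rational_loop_group
      \<subseteq> generate (rational_loop_group :: (ratfun ^ 'n ^ 'n) monoid) projective_loops"
    \<comment> \<open>For \<open>S = UNIV\<close> the condition on finished rows is vacuous.\<close>
    by (rule subsetI, rule loop_in_projective_group[of UNIV]) simp_all
qed

end
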